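(* Let $d=2$, $k\ge1$, and $\bm\beta=(1,1)$. For $\omega\in H^1(\Omega)$ let $\widetilde P\omega\in\mathbb V_h^k$ be the projection defined in the context. Then $\widetilde P$ preserves cell averages, and it also preserves the outflow-edge averages of $\omega$: for all $i,j$, $$\int_{y_{j-1/2}}^{y_{j+1/2}}(\widetilde P\omega)(x_{i+1/2}^-,y)\,dy=\int_{y_{j-1/2}}^{y_{j+1/2}}\omega(x_{i+1/2}^-,y)\,dy,$$ $$\int_{x_{i-1/2}}^{x_{i+1/2}}(\widetilde P\omega)(x,y_{j+1/2}^-)\,dx=\int_{x_{i-1/2}}^{x_{i+1/2}}\omega(x,y_{j+1/2}^-)\,dx.$$ As a consequence, $H_{i,j}(\widetilde P\omega,1)=H_{i,j}(\omega,1)$ for all $i,j$.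
   Context: $\Omega$ is a rectangle with periodic boundary conditions, with uniform Cartesian mesh $\mathcal T_h=\{I_{i,j}=[x_{i-1/2},x_{i+1/2}]\times[y_{j-1/2},y_{j+1/2}]\}$ of constant step sizes $h_x,h_y$. $\mathbb V_h^k=\{v\in L^2(\Omega):v|_{I_{i,j}}\in\mathbb P^k(I_{i,j})\ \forall i,j\}$, where $\mathbb P^k$ denotes polynomials of total degree at most $k$; $(\cdot,\cdot)_{i,j}$ is the $L^2(I_{i,j})$ inner product. Superscripts $\pm$ denote one-sided limits (traces from the left/below for $-$, from the right/above for $+$). With $\bm\beta=(1,1)$, define $$\mathbb P_h^*(\omega,v)_{i,j}=-(\omega,\bm\beta\cdot\nabla v)_{i,j}+\int_{x_{i-1/2}}^{x_{i+1/2}}\omega(x,y_{j+1/2}^-)\big(v(x,y_{j+1/2}^-)-v(x,y_{j-1/2}^+)\big)dx+\int_{y_{j-1/2}}^{y_{j+1/2}}\omega(x_{i+1/2}^-,y)\big(v(x_{i+1/2}^-,y)-v(x_{i-1/2}^+,y)\big)dy.$$ For $\omega\in H^1(\Omega)$, $\widetilde P\omega\in\mathbb V_h^k$ is the (unique) function satisfying, for all $i,j$, $\mathbb P_h^*(\widetilde P\omega,v)_{i,j}=\mathbb P_h^*(\omega,v)_{i,j}$ for all $v\in\mathbb P^k(I_{i,j})$ and $(\widetilde P\omega,1)_{i,j}=(\omega,1)_{i,j}$. The local upwind DG operator is $$H_{i,j}(\omega,v)=(\bm\beta\omega,\nabla v)_{i,j}+\int_{y_{j-1/2}}^{y_{j+1/2}}\big[\omega(x_{i-1/2}^-,y)v(x_{i-1/2}^+,y)-\omega(x_{i+1/2}^-,y)v(x_{i+1/2}^-,y)\big]dy+\int_{x_{i-1/2}}^{x_{i+1/2}}\big[\omega(x,y_{j-1/2}^-)v(x,y_{j-1/2}^+)-\omega(x,y_{j+1/2}^-)v(x,y_{j+1/2}^-)\big]dx.$$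 *)

theory Defs
  imports "HOL-Analysis.Analysis"
begin

section \<open>Periodic rectangle and uniform Cartesian mesh\<close>

text \<open>
  Cells are indexed from 0: cell \<open>(i, j)\<close> with \<open>i < nx M\<close>, \<open>j < ny M\<close> is
  \<open>[xnode M i, xnode M (Suc i)] \<times> [ynode M j, ynode M (Suc j)]\<close>, so that \<open>xnode M i\<close> is
  $x_{i-1/2}$ and \<open>xnode M (Suc i)\<close> is $x_{i+1/2}$.
\<close>

record mesh =
  xmin :: real
  ymin :: real
  hx :: real
  hy :: real
  nx :: nat
  ny :: nat

definition cartesian_mesh :: "mesh \<Rightarrow> bool" where
  "cartesian_mesh M \<longleftrightarrow> hx M > 0 \<and> hy M > 0 \<and> nx M \<ge> 1 \<and> ny M \<ge> 1"

definition xnode :: "mesh \<Rightarrow> nat \<Rightarrow> real" where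
  "xnode M i = xmin M + real i * hx M"

definition ynode :: "mesh \<Rightarrow> nat \<Rightarrow> real" where
  "ynode M j = ymin M + real j * hy M"

definition cell :: "mesh \<Rightarrow> nat \<Rightarrow> nat \<Rightarrow> (real \<times> real) set" where
  "cell M i j = {xnode M i..xnode M (Suc i)} \<times> {ynode M j..ynode M (Suc j)}"

definition Omega :: "mesh \<Rightarrow> (real \<times> real) set" where
  "Omega M = {xnode M 0..xnode M (nx M)} \<times> {ynode M 0..ynode M (ny M)}"

definition prev :: "nat \<Rightarrow> nat \<Rightarrow> nat" where
  "prev n i = (if i = 0 then n - 1 else i - 1)"


section \<open>Function spaces\<close>

text \<open>
  Elements of $L^2$ and $H^1$ are represented by functions on the plane, of which only the values
  almost everywhere on the domain matter.
\<close>

definition square_integrable_on :: "(real \<times> real \<Rightarrow> real) \<Rightarrow> (real \<times> real) set \<Rightarrow> bool"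
    (infixr "square'_integrable'_on" 46) where
  "f square_integrable_on S \<longleftrightarrow>
     set_borel_measurable lebesgue S f \<and> set_integrable lebesgue S (\<lambda>z. (f z)\<^sup>2)"

definition grad :: "(real \<times> real \<Rightarrow> real) \<Rightarrow> real \<times> real \<Rightarrow> real \<times> real" where
  "grad v z = (frechet_derivative v (at z) (1, 0), frechet_derivative v (at z) (0, 1))"

primrec C_k :: "nat \<Rightarrow> (real \<times> real \<Rightarrow> real) \<Rightarrow> bool" where
  "C_k 0 f \<longleftrightarrow> continuous_on UNIV f"
| "C_k (Suc n) f \<longleftrightarrow>
     f differentiable_on UNIV \<and> C_k n (\<lambda>z. fst (grad f z)) \<and> C_k n (\<lambda>z. snd (grad f z))"

definition test_function :: "(real \<times> real) set \<Rightarrow> (real \<times> real \<Rightarrow> real) \<Rightarrow> bool" where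
  "test_function U \<phi> \<longleftrightarrow>
     (\<forall>n. C_k n \<phi>) \<and> compact (closure {z. \<phi> z \<noteq> 0}) \<and> closure {z. \<phi> z \<noteq> 0} \<subseteq> U"

definition weak_gradient_on ::
    "(real \<times> real) set \<Rightarrow> (real \<times> real \<Rightarrow> real) \<Rightarrow> (real \<times> real \<Rightarrow> real) \<Rightarrow>
     (real \<times> real \<Rightarrow> real) \<Rightarrow> bool" where
  "weak_gradient_on U f g1 g2 \<longleftrightarrow> (\<forall>\<phi>. test_function U \<phi> \<longrightarrow>
     (LINT z:U|lebesgue. f z * fst (grad \<phi> z)) = - (LINT z:U|lebesgue. g1 z * \<phi> z) \<and>
     (LINT z:U|lebesgue. f z * snd (grad \<phi> z)) = - (LINT z:U|lebesgue. g2 z * \<phi> z))"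

text \<open>
  The Sobolev space $H^1$ of an open set. It is applied to the interior of the rectangle without
  requiring equal traces on opposite sides, so it contains the $H^1$ functions on the torus.
\<close>

definition H1 :: "(real \<times> real) set \<Rightarrow> (real \<times> real \<Rightarrow> real) set" where
  "H1 U = {f. f square_integrable_on U \<and>
     (\<exists>g1 g2. g1 square_integrable_on U \<and> g2 square_integrable_on U \<and>
              weak_gradient_on U f g1 g2)}"

text \<open>
  Polynomials of total degree at most \<open>k\<close>. A polynomial on a cell is identified with its unique
  polynomial extension to the plane.
\<close>

definition Pk :: "nat \<Rightarrow> (real \<times> real \<Rightarrow> real) set" where
  "Pk k = {p. \<exists>c :: nat \<Rightarrow> nat \<Rightarrow> real.
     p = (\<lambda>(x, y). \<Sum>(a, b)\<in>{(a, b). a + b \<le> k}. c a b * x ^ a * y ^ b)}"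

definition Vh :: "mesh \<Rightarrow> nat \<Rightarrow> (real \<times> real \<Rightarrow> real) set" where
  "Vh M k = {v. v square_integrable_on Omega M \<and>
     (\<forall>i<nx M. \<forall>j<ny M. \<exists>p\<in>Pk k. AE z in lebesgue. z \<in> cell M i j \<longrightarrow> v z = p z)}"


section \<open>One-sided traces\<close>

text \<open>
  The one-sided limits are essential limits: the values on a null set of the line are ignored. By
  Fubini the resulting trace of an $L^2$ class does not depend, up to a null set of the edge,
  on the representative. An $H^1$ function is, on almost every line parallel to an axis, almost
  everywhere equal to an absolutely continuous function, so for such functions these limits exist
  at almost every point of an edge and agree with the Sobolev trace.
\<close>

definition lim_minus :: "(real \<Rightarrow> real) \<Rightarrow> real \<Rightarrow> real" where
  "lim_minus f a = Lim (inf (at_left a) (ae_filter lebesgue)) f"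

definition lim_plus :: "(real \<Rightarrow> real) \<Rightarrow> real \<Rightarrow> real" where
  "lim_plus f a = Lim (inf (at_right a) (ae_filter lebesgue)) f"

text \<open>$w(x^-, y)$, $w(x^+, y)$, $w(x, y^-)$ and $w(x, y^+)$, respectively.\<close>

definition trxm :: "(real \<times> real \<Rightarrow> real) \<Rightarrow> real \<Rightarrow> real \<Rightarrow> real" where
  "trxm w x y = lim_minus (\<lambda>s. w (s, y)) x"

definition trxp :: "(real \<times> real \<Rightarrow> real) \<Rightarrow> real \<Rightarrow> real \<Rightarrow> real" where
  "trxp w x y = lim_plus (\<lambda>s. w (s, y)) x"

definition trym :: "(real \<times> real \<Rightarrow> real) \<Rightarrow> real \<Rightarrow> real \<Rightarrow> real" where
  "trym w x y = lim_minus (\<lambda>t. w (x, t)) y"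

definition tryp :: "(real \<times> real \<Rightarrow> real) \<Rightarrow> real \<Rightarrow> real \<Rightarrow> real" where
  "tryp w x y = lim_plus (\<lambda>t. w (x, t)) y"


section \<open>The forms and the projection\<close>

definition \<beta> :: "real \<times> real" where
  "\<beta> = (1, 1)"

definition inner_cell ::
    "mesh \<Rightarrow> nat \<Rightarrow> nat \<Rightarrow> (real \<times> real \<Rightarrow> real) \<Rightarrow> (real \<times> real \<Rightarrow> real) \<Rightarrow> real" where
  "inner_cell M i j f g = (LINT z:cell M i j|lebesgue. f z * g z)"

definition cell_average :: "mesh \<Rightarrow> nat \<Rightarrow> nat \<Rightarrow> (real \<times> real \<Rightarrow> real) \<Rightarrow> real" where
  "cell_average M i j f = (LINT z:cell M i j|lebesgue. f z) / measure lebesgue (cell M i j)"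

definition Ph_star ::
    "mesh \<Rightarrow> nat \<Rightarrow> nat \<Rightarrow> (real \<times> real \<Rightarrow> real) \<Rightarrow> (real \<times> real \<Rightarrow> real) \<Rightarrow> real" where
  "Ph_star M i j w v =
     - inner_cell M i j w (\<lambda>z. \<beta> \<bullet> grad v z)
     + (LINT x:{xnode M i..xnode M (Suc i)}|lebesgue.
          trym w x (ynode M (Suc j)) * (trym v x (ynode M (Suc j)) - tryp v x (ynode M j)))
     + (LINT y:{ynode M j..ynode M (Suc j)}|lebesgue.
          trxm w (xnode M (Suc i)) y * (trxm v (xnode M (Suc i)) y - trxp v (xnode M i) y))"

text \<open>
  \<open>is_proj M k w u\<close>: \<open>u\<close> is the projection of \<open>w\<close>. The conditions determine \<open>u\<close> only almost
  everywhere, hence a relation between representatives.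
\<close>

definition is_proj ::
    "mesh \<Rightarrow> nat \<Rightarrow> (real \<times> real \<Rightarrow> real) \<Rightarrow> (real \<times> real \<Rightarrow> real) \<Rightarrow> bool" where
  "is_proj M k w u \<longleftrightarrow> u \<in> Vh M k \<and>
     (\<forall>i<nx M. \<forall>j<ny M.
        (\<forall>v\<in>Pk k. Ph_star M i j u v = Ph_star M i j w v) \<and>
        inner_cell M i j u (\<lambda>_. 1) = inner_cell M i j w (\<lambda>_. 1))"

text \<open>
  The upwind inflow values $w(x_{i-1/2}^-, y)$ and $w(x, y_{j-1/2}^-)$ are traces from the
  preceding cell. Its right (top) edge has node index \<open>Suc (prev n i)\<close>, which is \<open>i\<close> for \<open>i > 0\<close>
  and, by periodicity, \<open>n\<close> for \<open>i = 0\<close>. Inflow and outflow contributions are integrated separately,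
  which is the same as integrating their difference because both traces are square integrable.
\<close>

definition H_loc ::
    "mesh \<Rightarrow> nat \<Rightarrow> nat \<Rightarrow> (real \<times> real \<Rightarrow> real) \<Rightarrow> (real \<times> real \<Rightarrow> real) \<Rightarrow> real" where
  "H_loc M i j w v =
     (LINT z:cell M i j|lebesgue. (w z *\<^sub>R \<beta>) \<bullet> grad v z)
     + ((LINT y:{ynode M j..ynode M (Suc j)}|lebesgue.
           trxm w (xnode M (Suc (prev (nx M) i))) y * trxp v (xnode M i) y)
        - (LINT y:{ynode M j..ynode M (Suc j)}|lebesgue.
             trxm w (xnode M (Suc i)) y * trxm v (xnode M (Suc i)) y))
     + ((LINT x:{xnode M i..xnode M (Suc i)}|lebesgue.
           trym w x (ynode M (Suc (prev (ny M) j))) * tryp v x (ynode M j))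
        - (LINT x:{xnode M i..xnode M (Suc i)}|lebesgue.
             trym w x (ynode M (Suc j)) * trym v x (ynode M (Suc j))))"

end

theory Submission
  imports Defs
begin

text \<open>
  The outflow averages are read off by testing the projection identity with the coordinate
  functions, which lie in $P^k$ because $k \ge 1$. For $v = x$ one has $\beta \cdot \nabla v = 1$,
  the jump of \<open>v\<close> between the bottom and the top edge vanishes, and its jump between the left and
  the right edge is the constant $h_x$. Hence
  \[ P_h^*(w, x)_{i,j} = -(w, 1)_{i,j} + h_x \int w(x_{i+1/2}^-, y)\, dy, \]
  and the right edge integral of \<open>w\<close> is a combination of two quantities that the projection
  preserves, $P_h^*(w, x)_{i,j}$ and $(w, 1)_{i,j}$ (\<open>Ph_star_fst\<close>). The function $v = y$ gives the
  top edge in the same way (\<open>Ph_star_snd\<close>).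

  For $v = 1$ the volume term of $H_{i,j}$ vanishes, and $H_{i,j}(w, 1)$ is the sum of inflow minus
  outflow edge integrals (\<open>H_loc_one\<close>). Since the inflow values are the upwind ones, every inflow
  edge of a cell is an outflow edge of the preceding cell (at the boundary by periodicity), so that
  preservation of all outflow averages gives preservation of $H_{i,j}(\cdot, 1)$.
\<close>

text \<open>
  This makes the filters of the essential one-sided limits proper, so that these limits are unique;
  for a continuous function, such as a test function on a line, they are the point values.
\<close>

lemma interval_meets_AE:
  fixes a b :: real
  assumes "a < b" and "AE x in lebesgue. P x"
  obtains x where "x \<in> {a<..<b}" and "P x"
proof (rule ccontr)
  assume "\<not> thesis"
  with that have "\<And>x. x \<in> {a<..<b} \<Longrightarrow> \<not> P x" by blast
  with assms(2) have "AE x in lebesgue. x \<notin> {a<..<b}"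
    by (auto elim: eventually_mono)
  then have "{a<..<b} \<in> null_sets lebesgue"
    by (subst AE_iff_null_sets) auto
  then have "emeasure lebesgue {a<..<b} = 0" by auto
  with \<open>a < b\<close> show False by simp
qed

lemma at_left_ae_neq_bot: "inf (at_left (a::real)) (ae_filter lebesgue) \<noteq> bot"
proof
  assume "inf (at_left a) (ae_filter lebesgue) = bot"
  then have "eventually (\<lambda>_. False) (inf (at_left a) (ae_filter lebesgue))" by simp
  then obtain Q R where Q: "eventually Q (at_left a)" and R: "AE x in lebesgue. R x"
    and QR: "\<And>x. Q x \<Longrightarrow> R x \<Longrightarrow> False"
    unfolding eventually_inf by blast
  from Q obtain b where "b < a" and "\<And>y. b < y \<Longrightarrow> y < a \<Longrightarrow> Q y"
    unfolding eventually_at_left_field by blast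
  with QR R show False by (metis interval_meets_AE greaterThanLessThan_iff)
qed

lemma at_right_ae_neq_bot: "inf (at_right (a::real)) (ae_filter lebesgue) \<noteq> bot"
proof
  assume "inf (at_right a) (ae_filter lebesgue) = bot"
  then have "eventually (\<lambda>_. False) (inf (at_right a) (ae_filter lebesgue))" by simp
  then obtain Q R where Q: "eventually Q (at_right a)" and R: "AE x in lebesgue. R x"
    and QR: "\<And>x. Q x \<Longrightarrow> R x \<Longrightarrow> False"
    unfolding eventually_inf by blast
  from Q obtain b where "a < b" and "\<And>y. a < y \<Longrightarrow> y < b \<Longrightarrow> Q y"
    unfolding eventually_at_right_field by blast
  with QR R show False by (metis interval_meets_AE greaterThanLessThan_iff)
qed

lemma lim_minus_isCont: "isCont f a \<Longrightarrow> lim_minus f a = f a"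
  unfolding lim_minus_def isCont_def
  by (intro tendsto_Lim at_left_ae_neq_bot)
     (auto intro: tendsto_mono[rotated] le_infI1 at_le)

lemma lim_plus_isCont: "isCont f a \<Longrightarrow> lim_plus f a = f a"
  unfolding lim_plus_def isCont_def
  by (intro tendsto_Lim at_right_ae_neq_bot)
     (auto intro: tendsto_mono[rotated] le_infI1 at_le)


lemma fst_in_Pk:
  assumes "k \<ge> 1"
  shows "fst \<in> Pk k"
proof -
  let ?S = "{(a, b). a + b \<le> k}" and ?c = "\<lambda>a b. if (a, b) = (1, 0) then 1 else (0::real)"
  have fin: "finite ?S"
    by (rule finite_subset[of _ "{..k} \<times> {..k}"]) auto
  have "(\<Sum>(a, b)\<in>?S. ?c a b * x ^ a * y ^ b) = (x::real)" for x y
  proof -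
    have "(\<Sum>(a, b)\<in>?S. ?c a b * x ^ a * y ^ b) = (\<Sum>p\<in>?S. if p = (1, 0) then x else 0)"
      by (intro sum.cong) (auto split: if_splits)
    also have "\<dots> = x" using fin assms by (simp add: sum.delta)
    finally show ?thesis .
  qed
  then show ?thesis
    unfolding Pk_def by (intro CollectI exI[of _ ?c]) (auto simp: fun_eq_iff)
qed

lemma snd_in_Pk:
  assumes "k \<ge> 1"
  shows "snd \<in> Pk k"
proof -
  let ?S = "{(a, b). a + b \<le> k}" and ?c = "\<lambda>a b. if (a, b) = (0, 1) then 1 else (0::real)"
  have fin: "finite ?S"
    by (rule finite_subset[of _ "{..k} \<times> {..k}"]) auto
  have "(\<Sum>(a, b)\<in>?S. ?c a b * x ^ a * y ^ b) = (y::real)" for x y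
  proof -
    have "(\<Sum>(a, b)\<in>?S. ?c a b * x ^ a * y ^ b) = (\<Sum>p\<in>?S. if p = (0, 1) then y else 0)"
      by (intro sum.cong) (auto split: if_splits)
    also have "\<dots> = y" using fin assms by (simp add: sum.delta)
    finally show ?thesis .
  qed
  then show ?thesis
    unfolding Pk_def by (intro CollectI exI[of _ ?c]) (auto simp: fun_eq_iff)
qed

lemma grad_fst: "grad fst z = (1, 0)"
proof -
  have "frechet_derivative fst (at z) = (fst :: real \<times> real \<Rightarrow> real)"
    by (rule frechet_derivative_at[symmetric]) (rule has_derivative_fst[OF has_derivative_ident])
  then show ?thesis by (simp add: grad_def)
qed

lemma grad_snd: "grad snd z = (0, 1)"
proof -
  have "frechet_derivative snd (at z) = (snd :: real \<times> real \<Rightarrow> real)"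
    by (rule frechet_derivative_at[symmetric]) (rule has_derivative_snd[OF has_derivative_ident])
  then show ?thesis by (simp add: grad_def)
qed

lemma grad_const: "grad (\<lambda>_. c) z = (0, 0)"
  by (simp add: grad_def)


text \<open>
  The jump of a coordinate function is constant along the edge and leaves the edge integral as the
  factor \<open>hx M\<close> or \<open>hy M\<close>; where the trace of \<open>w\<close> is not integrable, both sides of this step have the
  default value 0.
\<close>

lemma Ph_star_fst:
  "Ph_star M i j w fst = - inner_cell M i j w (\<lambda>_. 1)
     + hx M * (LINT y:{ynode M j..ynode M (Suc j)}|lebesgue. trxm w (xnode M (Suc i)) y)"
proof -
  have step: "xnode M (Suc i) - xnode M i = hx M"
    by (simp add: xnode_def algebra_simps)
  show ?thesis
    unfolding Ph_star_def
    by (simp add: \<beta>_def grad_fst trxm_def[of fst] trxp_def[of fst] trym_def[of fst]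
        tryp_def[of fst] lim_minus_isCont lim_plus_isCont step mult.commute)
qed

lemma Ph_star_snd:
  "Ph_star M i j w snd = - inner_cell M i j w (\<lambda>_. 1)
     + hy M * (LINT x:{xnode M i..xnode M (Suc i)}|lebesgue. trym w x (ynode M (Suc j)))"
proof -
  have step: "ynode M (Suc j) - ynode M j = hy M"
    by (simp add: ynode_def algebra_simps)
  show ?thesis
    unfolding Ph_star_def
    by (simp add: \<beta>_def grad_snd trxm_def[of snd] trxp_def[of snd] trym_def[of snd]
        tryp_def[of snd] lim_minus_isCont lim_plus_isCont step mult.commute)
qed

lemma H_loc_one:
  "H_loc M i j w (\<lambda>_. 1) =
     (LINT y:{ynode M j..ynode M (Suc j)}|lebesgue. trxm w (xnode M (Suc (prev (nx M) i))) y)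
     - (LINT y:{ynode M j..ynode M (Suc j)}|lebesgue. trxm w (xnode M (Suc i)) y)
     + ((LINT x:{xnode M i..xnode M (Suc i)}|lebesgue. trym w x (ynode M (Suc (prev (ny M) j))))
        - (LINT x:{xnode M i..xnode M (Suc i)}|lebesgue. trym w x (ynode M (Suc j))))"
  unfolding H_loc_def
  by (simp add: grad_const trxm_def[of "\<lambda>_. 1"] trxp_def[of "\<lambda>_. 1"] trym_def[of "\<lambda>_. 1"]
      tryp_def[of "\<lambda>_. 1"] lim_minus_isCont lim_plus_isCont zero_prod_def[symmetric])


lemma is_proj_right_edge:
  assumes "is_proj M k w u" and "k \<ge> 1" and "hx M > 0" and "i < nx M" and "j < ny M"
  shows "(LINT y:{ynode M j..ynode M (Suc j)}|lebesgue. trxm u (xnode M (Suc i)) y)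
       = (LINT y:{ynode M j..ynode M (Suc j)}|lebesgue. trxm w (xnode M (Suc i)) y)"
proof -
  have "Ph_star M i j u fst = Ph_star M i j w fst"
    and "inner_cell M i j u (\<lambda>_. 1) = inner_cell M i j w (\<lambda>_. 1)"
    using assms fst_in_Pk by (auto simp: is_proj_def)
  with \<open>hx M > 0\<close> show ?thesis by (simp add: Ph_star_fst)
qed

lemma is_proj_top_edge:
  assumes "is_proj M k w u" and "k \<ge> 1" and "hy M > 0" and "i < nx M" and "j < ny M"
  shows "(LINT x:{xnode M i..xnode M (Suc i)}|lebesgue. trym u x (ynode M (Suc j)))
       = (LINT x:{xnode M i..xnode M (Suc i)}|lebesgue. trym w x (ynode M (Suc j)))"
proof -
  have "Ph_star M i j u snd = Ph_star M i j w snd"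
    and "inner_cell M i j u (\<lambda>_. 1) = inner_cell M i j w (\<lambda>_. 1)"
    using assms snd_in_Pk by (auto simp: is_proj_def)
  with \<open>hy M > 0\<close> show ?thesis by (simp add: Ph_star_snd)
qed

lemma prev_less: "i < n \<Longrightarrow> prev n i < n"
  by (auto simp: prev_def)

theorem proposition4p15:
  fixes M :: mesh and k :: nat and \<omega> P\<omega> :: "real \<times> real \<Rightarrow> real"
  assumes "cartesian_mesh M"
    and "k \<ge> 1"
    and "\<omega> \<in> H1 (interior (Omega M))"
    and "is_proj M k \<omega> P\<omega>"
  shows "\<forall>i<nx M. \<forall>j<ny M.
      cell_average M i j P\<omega> = cell_average M i j \<omega> \<and>
      (LINT y:{ynode M j..ynode M (Suc j)}|lebesgue. trxm P\<omega> (xnode M (Suc i)) y)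
        = (LINT y:{ynode M j..ynode M (Suc j)}|lebesgue. trxm \<omega> (xnode M (Suc i)) y) \<and>
      (LINT x:{xnode M i..xnode M (Suc i)}|lebesgue. trym P\<omega> x (ynode M (Suc j)))
        = (LINT x:{xnode M i..xnode M (Suc i)}|lebesgue. trym \<omega> x (ynode M (Suc j))) \<and>
      H_loc M i j P\<omega> (\<lambda>_. 1) = H_loc M i j \<omega> (\<lambda>_. 1)"
proof (intro allI impI conjI)
  fix i j
  assume i: "i < nx M" and j: "j < ny M"
  have hx: "hx M > 0" and hy: "hy M > 0"
    using assms(1) by (auto simp: cartesian_mesh_def)
  note right = is_proj_right_edge[OF assms(4,2) hx]
  note top = is_proj_top_edge[OF assms(4,2) hy]
  have "inner_cell M i j P\<omega> (\<lambda>_. 1) = inner_cell M i j \<omega> (\<lambda>_. 1)"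
    using assms(4) i j by (auto simp: is_proj_def)
  then show "cell_average M i j P\<omega> = cell_average M i j \<omega>"
    by (simp add: cell_average_def inner_cell_def)
  show "(LINT y:{ynode M j..ynode M (Suc j)}|lebesgue. trxm P\<omega> (xnode M (Suc i)) y)
      = (LINT y:{ynode M j..ynode M (Suc j)}|lebesgue. trxm \<omega> (xnode M (Suc i)) y)"
    by (rule right[OF i j])
  show "(LINT x:{xnode M i..xnode M (Suc i)}|lebesgue. trym P\<omega> x (ynode M (Suc j)))
      = (LINT x:{xnode M i..xnode M (Suc i)}|lebesgue. trym \<omega> x (ynode M (Suc j)))"
    by (rule top[OF i j])
  show "H_loc M i j P\<omega> (\<lambda>_. 1) = H_loc M i j \<omega> (\<lambda>_. 1)"
    unfolding H_loc_one
    \<comment> \<open>The inflow edges are the outflow edges of the cells with indices \<open>(prev (nx M) i, j)\<close>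
        and \<open>(i, prev (ny M) j)\<close>.\<close>
    by (simp only: right[OF i j] right[OF prev_less[OF i] j]
        top[OF i j] top[OF i prev_less[OF j]])
qed

end
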